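(* Let $X$ be a complete, locally convex median space with compact intervals. Then the Roller compactification $\overline X$ is a compact, locally convex, topological median algebra. The inclusion $X\hookrightarrow\overline X$ is a continuous morphism of median algebras, whose image is convex and dense. It is a topological embedding if, in addition, $X$ is connected and locally compact.
   Context: A metric space $(X,d)$ is a median space if for all $x,y,z\in X$ there is a unique point $m(x,y,z)$ lying in $I(x,y)\cap I(y,z)\cap I(z,x)$, where $I(x,y)=\{z\in X\mid d(x,y)=d(x,z)+d(z,y)\}$. A median algebra is a set $M$ with a symmetric ternary operation $m$ satisfying $m(a,a,b)=a$ and $m(m(a,x,b),x,c)=m(a,x,m(b,x,c))$; every median space is a median algebra. In a median algebra, $I(x,y)=\{z\mid m(x,y,z)=z\}$ (for median spaces this agrees with the metric definition) and $C\subseteq M$ is convex if $I(x,y)\subseteq C$ for all $x,y\in C$. A morphism of median algebras is a map preserving $m$. A topological median algebra is a median algebra with a Hausdorff topology for which $m$ is continuous; it is locally convex if every point has a basis of convex neighbourhoods; it has compact intervals if each $I(x,y)$ is compact. A median space is a topological median algebra with its metric topology. Let $\mathcal{J}$ be the set of all intervals $I=I(x,y)$ of $X$ (singletons allowed); for $I=I(x,y)\in\mathcal{J}$ let $\pi_I\colon X\to I$, $\pi_I(z)=m(x,y,z)$, be the gate-projection (it depends only on the set $I$). A nonempty intersection of two intervals is again an interval. The Roller compactification of $X$ is $$\overline X=\Big\{(x_I)_I\in\prod_{I\in\mathcal{J}}I\ \Big|\ \pi_{I\cap J}(x_I)=\pi_{I\cap J}(x_J)\ \ \forall I,J\in\mathcal{J}\text{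 with }I\cap J\neq\emptyset\Big\},$$ with the componentwise median operation and the subspace topology of the product topology (each $I$ having its metric topology). The inclusion $X\hookrightarrow\overline X$ is $x\mapsto(\pi_I(x))_I$. *)

theory Defs
  imports "HOL-Analysis.Analysis"
begin

text \<open>A median algebra is given by a carrier set and an operation that is only constrained on
  the carrier.\<close>

definition median_algebra :: "'a set \<Rightarrow> ('a \<Rightarrow> 'a \<Rightarrow> 'a \<Rightarrow> 'a) \<Rightarrow> bool" where
  "median_algebra M m \<longleftrightarrow>
     (\<forall>a\<in>M. \<forall>b\<in>M. \<forall>c\<in>M. m a b c \<in> M) \<and>
     (\<forall>a\<in>M. \<forall>b\<in>M. \<forall>c\<in>M. m a b c = m b a c \<and> m a b c = m a c b) \<and>
     (\<forall>a\<in>M. \<forall>b\<in>M. m a a b = a) \<and>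
     (\<forall>a\<in>M. \<forall>b\<in>M. \<forall>c\<in>M. \<forall>x\<in>M. m (m a x b) x c = m a x (m b x c))"

definition median_interval :: "'a set \<Rightarrow> ('a \<Rightarrow> 'a \<Rightarrow> 'a \<Rightarrow> 'a) \<Rightarrow> 'a \<Rightarrow> 'a \<Rightarrow> 'a set" where
  "median_interval M m x y = {z \<in> M. m x y z = z}"

definition median_convex :: "'a set \<Rightarrow> ('a \<Rightarrow> 'a \<Rightarrow> 'a \<Rightarrow> 'a) \<Rightarrow> 'a set \<Rightarrow> bool" where
  "median_convex M m C \<longleftrightarrow> C \<subseteq> M \<and> (\<forall>x\<in>C. \<forall>y\<in>C. median_interval M m x y \<subseteq> C)"

definition median_morphism ::
  "'a set \<Rightarrow> ('a \<Rightarrow> 'a \<Rightarrow> 'a \<Rightarrow> 'a) \<Rightarrow> 'b set \<Rightarrow> ('b \<Rightarrow> 'b \<Rightarrow> 'b \<Rightarrow> 'b) \<Rightarrow> ('a \<Rightarrow> 'b) \<Rightarrow> bool" where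
  "median_morphism M m N n f \<longleftrightarrow>
     f \<in> M \<rightarrow> N \<and> (\<forall>x\<in>M. \<forall>y\<in>M. \<forall>z\<in>M. f (m x y z) = n (f x) (f y) (f z))"

definition topological_median_algebra :: "'a topology \<Rightarrow> ('a \<Rightarrow> 'a \<Rightarrow> 'a \<Rightarrow> 'a) \<Rightarrow> bool" where
  "topological_median_algebra T m \<longleftrightarrow>
     median_algebra (topspace T) m \<and> Hausdorff_space T \<and>
     continuous_map (prod_topology T (prod_topology T T)) T (\<lambda>(x, y, z). m x y z)"

text \<open>Neighbourhoods need not be open.\<close>

definition locally_median_convex :: "'a topology \<Rightarrow> ('a \<Rightarrow> 'a \<Rightarrow> 'a \<Rightarrow> 'a) \<Rightarrow> bool" where
  "locally_median_convex T m \<longleftrightarrow> neighbourhood_base_of (median_convex (topspace T) m) T"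

definition compact_median_intervals :: "'a topology \<Rightarrow> ('a \<Rightarrow> 'a \<Rightarrow> 'a \<Rightarrow> 'a) \<Rightarrow> bool" where
  "compact_median_intervals T m \<longleftrightarrow>
     (\<forall>x\<in>topspace T. \<forall>y\<in>topspace T. compactin T (median_interval (topspace T) m x y))"

definition (in metric_space) metric_interval :: "'a \<Rightarrow> 'a \<Rightarrow> 'a set" where
  "metric_interval x y = {z. dist x y = dist x z + dist z y}"

class median_space = metric_space +
  assumes ex1_median:
    "\<exists>!w. w \<in> metric_interval x y \<inter> metric_interval y z \<inter> metric_interval z x"

definition median :: "'a::median_space \<Rightarrow> 'a \<Rightarrow> 'a \<Rightarrow> 'a" where
  "median x y z = (THE w. w \<in> metric_interval x y \<inter> metric_interval y z \<inter> metric_interval z x)"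

definition intervals :: "'a::median_space set set" where
  "intervals = {metric_interval x y | x y. True}"

text \<open>The gate-projection to \<open>I\<close> does not depend on the choice of endpoints \<open>x\<close>, \<open>y\<close> of \<open>I\<close>, so
  the description below is definite for every \<open>I \<in> intervals\<close>.\<close>

definition gate :: "'a::median_space set \<Rightarrow> 'a \<Rightarrow> 'a" where
  "gate I z = (THE w. \<exists>x y. I = metric_interval x y \<and> w = median x y z)"

text \<open>Families indexed by the intervals are extensional functions, as in \<^const>\<open>product_topology\<close>.\<close>

definition roller :: "('a::median_space set \<Rightarrow> 'a) set" where
  "roller = {f \<in> (\<Pi>\<^sub>E I\<in>intervals. I).
     \<forall>I\<in>intervals. \<forall>J\<in>intervals. I \<inter> J \<noteq> {} \<longrightarrow> gate (I \<inter> J) (f I) = gate (I \<inter> J) (f J)}"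

definition roller_median ::
  "('a::median_space set \<Rightarrow> 'a) \<Rightarrow> ('a set \<Rightarrow> 'a) \<Rightarrow> ('a set \<Rightarrow> 'a) \<Rightarrow> ('a set \<Rightarrow> 'a)" where
  "roller_median f g h = (\<lambda>I\<in>intervals. median (f I) (g I) (h I))"

definition roller_topology :: "('a::median_space set \<Rightarrow> 'a) topology" where
  "roller_topology = subtopology (product_topology (\<lambda>I. top_of_set I) intervals) roller"

lemma topspace_roller_topology: "topspace roller_topology = roller"
  by (auto simp: roller_topology_def roller_def)

definition roller_inclusion :: "'a::median_space \<Rightarrow> ('a set \<Rightarrow> 'a)" where
  "roller_inclusion x = (\<lambda>I\<in>intervals. gate I x)"

end

(* A point of X has a gate in every interval: the median of the point and the endpoints.  Gates
   are 1-Lipschitz and map intervals to intervals, hence are morphisms; all componentwise claims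
   about the compactification, which is a closed subspace of a product of compact intervals, follow.
   For density, the sets of points whose gate in I is a prescribed component f(I) are convex and meet
   pairwise, so finitely many of them have a common point by the Helly property of convex sets in a
   median algebra. *)

theory Submission
  imports Defs
begin

section \<open>Gates of intervals\<close>

text \<open>The fact behind most manipulations is that the gate of x in I lies between x and every
  point of I. This is independent of the chosen endpoints and turns uniqueness questions into
  antisymmetry of betweenness. Two claims resist a componentwise argument. Compatibility relates
  only intervals that meet, so convexity of the image needs intermediate intervals. And a
  neighbourhood in the product controls only finitely many gates, while points may leave a ball in
  infinitely many directions, so the embedding relies on compact spheres that every interval leading
  far enough out must cross.\<close>

lemma mem_metric_interval: "z \<in> metric_interval x y \<longleftrightarrow> dist x y = dist x z + dist z y"
  by (simp add: metric_interval_def)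

lemma metric_interval_commute: "metric_interval x y = metric_interval y (x::'a::metric_space)"
  by (auto simp: mem_metric_interval dist_commute)

lemma metric_interval_ends [simp]:
  "x \<in> metric_interval x y" "(y::'a::metric_space) \<in> metric_interval x y"
  by (auto simp: mem_metric_interval)

lemma metric_interval_self [simp]: "z \<in> metric_interval x x \<longleftrightarrow> z = (x::'a::metric_space)"
  by (auto simp: mem_metric_interval dist_commute)

lemma metric_interval_trans:
  fixes a b x y :: "'a::metric_space"
  assumes "y \<in> metric_interval a b" "x \<in> metric_interval a y"
  shows "x \<in> metric_interval a b" "y \<in> metric_interval x b"
  using assms dist_triangle[of a b x] dist_triangle[of x b y] by (auto simp: mem_metric_interval)

lemma metric_interval_trans':
  fixes a b x y :: "'a::metric_space"
  assumes "y \<in> metric_interval a b" "x \<in> metric_interval y b"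
  shows "x \<in> metric_interval a b" "y \<in> metric_interval a x"
  using assms metric_interval_trans[of y b a x] by (auto simp: metric_interval_commute)

text \<open>For fixed \<open>a\<close>, reading \<open>x \<in> metric_interval a y\<close> as "x is
  below y" gives a partial order, with \<open>metric_interval_trans\<close> as transitivity.
  Uniqueness of gates and of meets comes down to this antisymmetry.\<close>

lemma metric_interval_antisym:
  fixes a x y :: "'a::metric_space"
  assumes "x \<in> metric_interval a y" "y \<in> metric_interval a x"
  shows "x = y"
  using assms zero_le_dist[of x y] by (auto simp: mem_metric_interval dist_commute)

lemma median_in:
  fixes x y z :: "'a::median_space"
  shows "median x y z \<in> metric_interval x y"
    and "median x y z \<in> metric_interval y z"
    and "median x y z \<in> metric_interval z x"
  using theI'[OF ex1_median[of x y z]] by (auto simp: median_def)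

lemma median_eqI:
  fixes x y z :: "'a::median_space"
  assumes "w \<in> metric_interval x y" "w \<in> metric_interval y z" "w \<in> metric_interval z x"
  shows "median x y z = w"
  unfolding median_def using assms by (intro the1_equality[OF ex1_median]) auto

lemma median_commute:
  fixes x y z :: "'a::median_space"
  shows "median x y z = median y x z" "median x y z = median x z y"
  using median_in[of y x z] median_in[of x z y] metric_interval_commute
  by (metis median_eqI)+

lemma median_eq_iff: "median x y z = z \<longleftrightarrow> z \<in> metric_interval x (y::'a::median_space)"
  by (metis median_eqI median_in(1) metric_interval_ends)

text \<open>Project \<open>x\<close> first towards \<open>a\<close> along \<open>z\<close>, then towards \<open>b\<close>: the result lies in all three
  intervals that characterise the median of \<open>a\<close>, \<open>b\<close>, \<open>x\<close>.\<close>

lemma median_between: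
  fixes a b x z :: "'a::median_space"
  assumes "z \<in> metric_interval a b"
  shows "median a b x \<in> metric_interval x z"
proof -
  define u where "u = median x z a"
  define v where "v = median x u b"
  have u: "u \<in> metric_interval x z" "u \<in> metric_interval a z" "u \<in> metric_interval x a"
    using median_in[of x z a] by (auto simp: u_def metric_interval_commute)
  have v: "v \<in> metric_interval x u" "v \<in> metric_interval u b" "v \<in> metric_interval b x"
    using median_in[of x u b] by (auto simp: v_def)
  have "v \<in> metric_interval x z" "v \<in> metric_interval x a"
    using u v(1) metric_interval_trans(1) by blast+
  moreover have "v \<in> metric_interval a b"
    using assms u(2) v(2) metric_interval_trans(1) metric_interval_trans'(1) by blast
  ultimately show ?thesis
    using v(3) median_eqI[of v a b x] by (simp add: metric_interval_commute)
qed

text \<open>Candidates obtained from different endpoints of the same interval both lie in it, so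
  each lies between \<open>x\<close> and the other.\<close>

lemma gate_metric_interval [simp]:
  "gate (metric_interval a b) x = median a b (x::'a::median_space)"
  unfolding gate_def
proof (rule the_equality)
  fix w assume "\<exists>c d. metric_interval a b = metric_interval c d \<and> w = median c d x"
  then obtain c d where cd: "metric_interval a b = metric_interval c d" "w = median c d x"
    by blast
  then have "w \<in> metric_interval x (median a b x)" "median a b x \<in> metric_interval x w"
    using median_between[of _ a b x] median_between[of _ c d x] median_in(1) by metis+
  then show "w = median a b x"
    by (rule metric_interval_antisym)
qed blast

lemma metric_interval_in_intervals [simp]: "metric_interval x y \<in> intervals"
  by (auto simp: intervals_def)

context
  fixes I :: "'a::median_space set"
  assumes I: "I \<in> intervals"
begin

lemma gate_in: "gate I x \<in> I"
  using I median_in(1) by (auto simp: intervals_def)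

lemma gate_between: "z \<in> I \<Longrightarrow> gate I x \<in> metric_interval x z"
  using I median_between by (auto simp: intervals_def)

lemma gate_eqI: "g \<in> I \<Longrightarrow> (\<And>z. z \<in> I \<Longrightarrow> g \<in> metric_interval x z) \<Longrightarrow> gate I x = g"
  using gate_in gate_between metric_interval_antisym by metis

lemma gate_fixed: "x \<in> I \<Longrightarrow> gate I x = x"
  by (simp add: gate_eqI)

text \<open>If g is the gate of w, then d(x,y) = d(x,w) + d(w,y) = d(x,g) + d(g,y) + 2 d(w,g), so
  the triangle inequality forces w = g.\<close>

lemma metric_interval_subset:
  assumes "x \<in> I" "y \<in> I"
  shows "metric_interval x y \<subseteq> I"
proof
  fix w assume w: "w \<in> metric_interval x y"
  have "gate I w \<in> metric_interval w x" "gate I w \<in> metric_interval w y"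
    using assms gate_between by auto
  then have "dist w (gate I w) \<le> 0"
    using w dist_triangle[of x y "gate I w"] by (simp add: mem_metric_interval dist_commute)
  then show "w \<in> I"
    using gate_in[of w] by simp
qed

text \<open>With gates g of x and h of y, d(x,h) = d(x,g) + d(g,h) and d(y,g) = d(y,h) + d(h,g).
  Adding these and bounding the left sides through y and x respectively leaves 2 d(g,h) \<le> 2
  d(x,y).\<close>

lemma dist_gate_le: "dist (gate I x) (gate I y) \<le> dist x y"
  using gate_between[OF gate_in, of x y] gate_between[OF gate_in, of y x]
    dist_triangle[of x "gate I y" y] dist_triangle[of y "gate I x" x]
  by (simp add: mem_metric_interval dist_commute)

end

text \<open>With respect to the order \<open>u \<le> v \<longleftrightarrow> u \<in> I(x, v)\<close> based at \<open>x\<close>, the median of \<open>a\<close>, \<open>x\<close>, \<open>b\<close> is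
  the meet of \<open>a\<close> and \<open>b\<close>.\<close>

lemma median_greatest:
  fixes a b x w :: "'a::median_space"
  assumes "w \<in> metric_interval x a" "w \<in> metric_interval x b"
  shows "w \<in> metric_interval x (median a x b)"
proof -
  define v where "v = median w a b"
  have v: "v \<in> metric_interval w a" "v \<in> metric_interval w b" "v \<in> metric_interval a b"
    using median_in[of w a b] by (auto simp: v_def metric_interval_commute)
  then have "v \<in> metric_interval x a" "v \<in> metric_interval x b" "w \<in> metric_interval x v"
    using assms metric_interval_trans' by blast+
  then show ?thesis
    using v(3) median_eqI[of v a x b] by (simp add: metric_interval_commute)
qed

text \<open>Both sides are the meet of \<open>a\<close>, \<open>b\<close>, \<open>c\<close> in the
  order based at \<open>x\<close>: they have the same lower bounds, so each is below the
  other.\<close>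

lemma median_assoc:
  fixes a b c x :: "'a::median_space"
  shows "median (median a x b) x c = median a x (median b x c)"
proof -
  define le where "le u v \<longleftrightarrow> u \<in> metric_interval x v" for u v
  have le: "le w (median a x b) \<longleftrightarrow> le w a \<and> le w b" for w a b
    unfolding le_def using median_greatest median_in[of a x b] metric_interval_trans(1)
    by (metis metric_interval_commute)
  show ?thesis
    by (rule metric_interval_antisym[of _ x]; fold le_def)
      (metis le le_def metric_interval_ends(2))+
qed

text \<open>The median \<open>q\<close> of the three gates lies in \<open>I\<close>, and it lies
  between \<open>p\<close> and both \<open>x\<close> and \<open>y\<close>, hence between
  \<open>p\<close> and \<open>median x p y\<close>, which in turn lies between \<open>p\<close> and
  \<open>z\<close>. But the gate \<open>p\<close> of \<open>z\<close> lies between \<open>z\<close>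
  and any point of \<open>I\<close>, so p = q.\<close>

lemma gate_mono_interval:
  fixes I :: "'a::median_space set"
  assumes I: "I \<in> intervals" and z: "z \<in> metric_interval x y"
  shows "gate I z \<in> metric_interval (gate I x) (gate I y)"
proof -
  define p g h where "p = gate I z" and "g = gate I x" and "h = gate I y"
  define q where "q = median g p h"
  have in_I: "p \<in> I" "g \<in> I" "h \<in> I"
    using I gate_in by (auto simp: p_def g_def h_def)
  have q: "q \<in> metric_interval p g" "q \<in> metric_interval p h" "q \<in> metric_interval g h"
    using median_in[of g p h] by (auto simp: q_def metric_interval_commute)
  have "g \<in> metric_interval p x" "h \<in> metric_interval p y"
    unfolding g_def h_def using gate_between[OF I in_I(1)] metric_interval_commute by blast+
  then have "q \<in> metric_interval p (median x p y)"
    using q metric_interval_trans(1) median_greatest by metis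
  moreover have "median x p y \<in> metric_interval p z"
    using median_between[OF z, of p] median_commute by metis
  ultimately have "q \<in> metric_interval p z"
    using metric_interval_trans(1) by blast
  moreover have "q \<in> I"
    using metric_interval_subset[OF I in_I(2,3)] q(3) by blast
  then have "p \<in> metric_interval q z"
    using gate_between[OF I] by (auto simp: p_def metric_interval_commute)
  ultimately have "p = q"
    using metric_interval_antisym by (metis metric_interval_commute)
  then show ?thesis
    using q(3) by (simp add: p_def g_def h_def)
qed

lemma gate_median:
  "I \<in> intervals \<Longrightarrow> gate I (median x y z) = median (gate I x) (gate I y) (gate I (z::'a::median_space))"
  by (rule median_eqI[symmetric]; intro gate_mono_interval median_in)

lemma gate_gate_subset:
  fixes I J :: "'a::median_space set"
  assumes "I \<in> intervals" "J \<in> intervals" "I \<subseteq> J"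
  shows "gate I (gate J x) = gate I x"
proof (rule gate_eqI[OF assms(1), symmetric])
  fix z assume "z \<in> I"
  then show "gate I (gate J x) \<in> metric_interval x z"
    using assms gate_between metric_interval_trans'(1) by (metis subsetD)
qed (use assms gate_in in blast)

text \<open>The gate lies between \<open>x\<close> and any common point of \<open>I\<close> and
  \<open>J\<close>, and \<open>I\<close> is convex.\<close>

lemma gate_in_Int:
  fixes I J :: "'a::median_space set"
  assumes "I \<in> intervals" "J \<in> intervals" "I \<inter> J \<noteq> {}" "x \<in> I"
  shows "gate J x \<in> I \<inter> J"
proof -
  obtain p where "p \<in> I" "p \<in> J"
    using assms(3) by blast
  then have "gate J x \<in> metric_interval x p" "metric_interval x p \<subseteq> I"
    using assms gate_between metric_interval_subset by metis+
  then show ?thesis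
    using gate_in[OF assms(2)] by blast
qed

text \<open>The new endpoints are the gates in \<open>J\<close> of the endpoints of
  \<open>I\<close>: a common point is its own gate in \<open>J\<close>, hence lies between
  them.\<close>

lemma intervals_Int:
  fixes I J :: "'a::median_space set"
  assumes I: "I \<in> intervals" and J: "J \<in> intervals" and ne: "I \<inter> J \<noteq> {}"
  shows "I \<inter> J \<in> intervals"
proof -
  obtain a b where ab: "I = metric_interval a b"
    using I by (auto simp: intervals_def)
  have "gate J a \<in> I \<inter> J" "gate J b \<in> I \<inter> J"
    using gate_in_Int[OF I J ne] ab by auto
  then have "metric_interval (gate J a) (gate J b) \<subseteq> I \<inter> J"
    using I J metric_interval_subset by blast
  moreover have "I \<inter> J \<subseteq> metric_interval (gate J a) (gate J b)"
    using gate_mono_interval[OF J] gate_fixed[OF J] ab by fastforce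
  ultimately show ?thesis
    by (metis metric_interval_in_intervals subset_antisym)
qed

lemma gate_Int:
  fixes I J :: "'a::median_space set"
  assumes "I \<in> intervals" "J \<in> intervals" "I \<inter> J \<noteq> {}" "x \<in> I"
  shows "gate (I \<inter> J) x = gate J x"
  using gate_in_Int[OF assms] gate_between[OF assms(2)] intervals_Int[OF assms(1-3)]
  by (intro gate_eqI) auto

section \<open>Continuity of the median and of gates\<close>

lemma dist_median_le:
  fixes x y z w :: "'a::median_space"
  shows "dist (median x y z) (median x y w) \<le> dist z w"
  using dist_gate_le[of "metric_interval x y" z w] by simp

text \<open>One argument changes at a time; by symmetry each change compares the gates of two points
  in one interval.\<close>

lemma dist_median_le3:
  fixes x y z x' y' z' :: "'a::median_space"
  shows "dist (median x y z) (median x' y' z') \<le> dist x x' + dist y y' + dist z z'"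
proof -
  have "dist (median x y z) (median x y z') \<le> dist z z'"
    by (rule dist_median_le)
  moreover have "dist (median x y z') (median x y' z') \<le> dist y y'"
    using dist_median_le[of x z' y y'] by (simp add: median_commute(2))
  moreover have "dist (median x y' z') (median x' y' z') \<le> dist x x'"
    using dist_median_le[of y' z' x x'] by (metis median_commute)
  ultimately show ?thesis
    using dist_triangle[of "median x y z" "median x' y' z'" "median x y z'"]
      dist_triangle[of "median x y z'" "median x' y' z'" "median x y' z'"] by linarith
qed

lemma tendsto_median:
  fixes f g h :: "_ \<Rightarrow> 'a::median_space"
  assumes "(f \<longlongrightarrow> x) F" "(g \<longlongrightarrow> y) F" "(h \<longlongrightarrow> z) F"
  shows "((\<lambda>t. median (f t) (g t) (h t)) \<longlongrightarrow> median x y z) F"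
proof -
  have "((\<lambda>t. dist (f t) x + dist (g t) y + dist (h t) z) \<longlongrightarrow> 0) F"
    using assms[THEN tendsto_dist_iff[THEN iffD1]] by (auto intro!: tendsto_add_zero)
  then have "((\<lambda>t. dist (median (f t) (g t) (h t)) (median x y z)) \<longlongrightarrow> 0) F"
    by (rule tendsto_0_le[where K = 1], intro always_eventually allI) (simp add: dist_median_le3)
  then show ?thesis
    by (rule tendsto_dist_iff[THEN iffD2])
qed

lemma continuous_map_median:
  fixes f g h :: "_ \<Rightarrow> 'a::median_space"
  assumes "continuous_map T euclidean f" "continuous_map T euclidean g" "continuous_map T euclidean h"
  shows "continuous_map T euclidean (\<lambda>t. median (f t) (g t) (h t))"
  using assms tendsto_median unfolding continuous_map_atin limitin_canonical_iff by blast

lemma continuous_map_gate: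
  fixes I :: "'a::median_space set"
  assumes "I \<in> intervals"
  shows "continuous_map euclidean euclidean (gate I)"
proof -
  obtain a b where "I = metric_interval a b"
    using assms by (auto simp: intervals_def)
  then have "gate I = (\<lambda>x. median a b x)"
    by (simp add: fun_eq_iff)
  then show ?thesis
    using continuous_map_median[of euclidean "\<lambda>_. a" "\<lambda>_. b" "\<lambda>x. x"] by simp
qed

section \<open>The Roller compactification\<close>

lemma rollerD:
  assumes "f \<in> roller"
  shows "f \<in> extensional intervals"
    and "I \<in> intervals \<Longrightarrow> f I \<in> I"
    and "I \<in> intervals \<Longrightarrow> J \<in> intervals \<Longrightarrow> I \<inter> J \<noteq> {} \<Longrightarrow> gate (I \<inter> J) (f I) = gate (I \<inter> J) (f J)"
  using assms by (auto simp: roller_def PiE_iff)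

lemma roller_eqI:
  "f \<in> roller \<Longrightarrow> g \<in> roller \<Longrightarrow> (\<And>I. I \<in> intervals \<Longrightarrow> f I = g I) \<Longrightarrow> f = g"
  using rollerD(1) extensionalityI by blast

text \<open>For nested intervals the intersection is \<open>I\<close>, whose gate fixes
  \<open>f I\<close>; compatibility then says that components at larger intervals determine those at
  smaller ones.\<close>

lemma roller_gate_subset:
  assumes "f \<in> roller" "I \<in> intervals" "J \<in> intervals" "I \<subseteq> J"
  shows "f I = gate I (f J)"
proof -
  have "I \<inter> J = I"
    using assms(4) by blast
  moreover have "f I \<in> I"
    using assms by (simp add: rollerD(2))
  ultimately show ?thesis
    using assms(2) rollerD(3)[OF assms(1-3)] gate_fixed by fastforce
qed

lemma roller_inclusion_apply [simp]: "I \<in> intervals \<Longrightarrow> roller_inclusion x I = gate I x"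
  by (simp add: roller_inclusion_def)

lemma roller_median_apply [simp]:
  "I \<in> intervals \<Longrightarrow> roller_median f g h I = median (f I) (g I) (h I)"
  by (simp add: roller_median_def)

lemma rollerI:
  assumes "f \<in> extensional intervals" "\<And>I. I \<in> intervals \<Longrightarrow> f I \<in> I"
    and "\<And>I J. I \<in> intervals \<Longrightarrow> J \<in> intervals \<Longrightarrow> I \<inter> J \<in> intervals \<Longrightarrow>
      I \<inter> J \<noteq> {} \<Longrightarrow> gate (I \<inter> J) (f I) = gate (I \<inter> J) (f J)"
  shows "f \<in> roller"
  unfolding roller_def PiE_iff using assms intervals_Int by blast

lemma roller_inclusion_in_roller: "roller_inclusion x \<in> roller"
  by (rule rollerI) (simp_all add: roller_inclusion_def gate_in gate_gate_subset)

lemma roller_median_in_roller: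
  assumes "f \<in> roller" "g \<in> roller" "h \<in> roller"
  shows "roller_median f g h \<in> roller"
proof (rule rollerI)
  fix I :: "'a set" assume I: "I \<in> intervals"
  then show "roller_median f g h I \<in> I"
    using metric_interval_subset[OF I, of "f I" "g I"] median_in(1) assms
    by (auto simp: rollerD(2))
next
  fix I J :: "'a set"
  assume *: "I \<in> intervals" "J \<in> intervals" "I \<inter> J \<in> intervals" "I \<inter> J \<noteq> {}"
  show "gate (I \<inter> J) (roller_median f g h I) = gate (I \<inter> J) (roller_median f g h J)"
    unfolding roller_median_apply[OF *(1)] roller_median_apply[OF *(2)] gate_median[OF *(3)]
    using assms[THEN rollerD(3), OF *(1,2,4)] by simp
qed (simp add: roller_median_def)

lemma median_algebra_roller: "median_algebra roller roller_median"
  unfolding median_algebra_def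
proof (intro conjI ballI roller_median_in_roller)
  fix a b c :: "'a set \<Rightarrow> 'a"
  assume *: "a \<in> roller" "b \<in> roller" "c \<in> roller"
  show "roller_median a b c = roller_median b a c" "roller_median a b c = roller_median a c b"
    unfolding roller_median_def by (rule restrict_ext, rule median_commute)+
next
  fix a b :: "'a set \<Rightarrow> 'a"
  assume "a \<in> roller" "b \<in> roller"
  then show "roller_median a a b = a"
    by (intro roller_eqI roller_median_in_roller) (simp_all add: median_eqI)
next
  fix a b c x :: "'a set \<Rightarrow> 'a"
  assume "a \<in> roller" "b \<in> roller" "c \<in> roller" "x \<in> roller"
  then show "roller_median (roller_median a x b) x c = roller_median a x (roller_median b x c)"
    by (intro roller_eqI roller_median_in_roller) (simp_all add: median_assoc)
qed

lemma median_interval_roller: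
  assumes "h \<in> median_interval roller roller_median f g" "I \<in> intervals"
  shows "h I \<in> metric_interval (f I) (g I)"
proof -
  have "roller_median f g h = h"
    using assms(1) by (simp add: median_interval_def)
  then have "median (f I) (g I) (h I) = h I"
    using roller_median_apply[OF assms(2), of f g h] by simp
  then show ?thesis
    by (simp only: median_eq_iff)
qed

section \<open>Topology of the compactification\<close>

lemma continuous_map_into_roller:
  assumes "\<And>t. t \<in> topspace T \<Longrightarrow> F t \<in> roller"
    and "\<And>I. I \<in> intervals \<Longrightarrow> continuous_map T euclidean (\<lambda>t. F t I)"
  shows "continuous_map T roller_topology F"
  using assms rollerD(1,2)[OF assms(1)]
  by (auto simp: roller_topology_def continuous_map_in_subtopology continuous_map_componentwise)

lemma continuous_map_roller_apply:
  assumes "I \<in> intervals"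
  shows "continuous_map roller_topology euclidean (\<lambda>f. f I)"
  using continuous_map_product_projection[OF assms, of "\<lambda>I. top_of_set I"]
  by (simp add: roller_topology_def continuous_map_from_subtopology continuous_map_in_subtopology)

lemma openin_roller_apply:
  assumes "I \<in> intervals" "open V"
  shows "openin roller_topology {f \<in> roller. f I \<in> V}"
  using openin_continuous_map_preimage[OF continuous_map_roller_apply[OF assms(1)], of V] assms(2)
  by (simp add: topspace_roller_topology)

lemma openin_roller_finite:
  assumes "finite F" "F \<subseteq> intervals" "\<And>I. I \<in> F \<Longrightarrow> open (V I)"
  shows "openin roller_topology {f \<in> roller. \<forall>I\<in>F. f I \<in> V I}"
  using assms
proof (induction F rule: finite_induct)
  case empty
  show ?case
    using openin_topspace[of roller_topology] by (simp add: topspace_roller_topology)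
next
  case (insert I F)
  have "{f \<in> roller. \<forall>J\<in>insert I F. f J \<in> V J} =
      {f \<in> roller. f I \<in> V I} \<inter> {f \<in> roller. \<forall>J\<in>F. f J \<in> V J}"
    by blast
  then show ?case
    using insert openin_roller_apply[of I "V I"] by (auto intro: openin_Int)
qed

lemma openin_roller_basis:
  fixes U :: "('a::median_space set \<Rightarrow> 'a) set"
  assumes "openin roller_topology U" "f \<in> U"
  obtains F V where "finite F" "F \<subseteq> intervals" "\<And>I. I \<in> F \<Longrightarrow> open (V I) \<and> f I \<in> V I"
    "\<And>g. g \<in> roller \<Longrightarrow> (\<And>I. I \<in> F \<Longrightarrow> g I \<in> V I) \<Longrightarrow> g \<in> U"
proof -
  obtain U' where U': "openin (product_topology (\<lambda>I::'a set. top_of_set I) intervals) U'"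
    "U = U' \<inter> roller"
    using assms(1) unfolding roller_topology_def openin_subtopology by blast
  then have fr: "f \<in> roller" and "f \<in> U'"
    using assms(2) by auto
  obtain X where X: "f \<in> (\<Pi>\<^sub>E I\<in>intervals. X I)" "\<And>I. openin (top_of_set I) (X I)"
    "finite {I. X I \<noteq> topspace (top_of_set I)}" "(\<Pi>\<^sub>E I\<in>intervals. X I) \<subseteq> U'"
    using product_topology_open_contains_basis[OF U'(1) \<open>f \<in> U'\<close>] by blast
  define F where "F = {I \<in> intervals. X I \<noteq> I}"
  \<comment> \<open>\<open>X I\<close> is open only relative to \<open>I\<close>; an open set of the
    whole space cutting it out frees later arguments from the factor spaces.\<close>
  obtain V where V: "\<And>I. open (V I) \<and> X I = I \<inter> V I"
    using X(2) unfolding openin_open by metis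
  have "finite F"
    by (rule finite_subset[OF _ X(3)]) (auto simp: F_def)
  moreover have "F \<subseteq> intervals"
    by (auto simp: F_def)
  moreover have "open (V I) \<and> f I \<in> V I" if "I \<in> F" for I
    using that X(1) V[of I] by (auto simp: F_def)
  moreover have "g \<in> U" if g: "g \<in> roller" and gV: "\<And>I. I \<in> F \<Longrightarrow> g I \<in> V I" for g
  proof -
    have "g I \<in> X I" if "I \<in> intervals" for I
      using rollerD(2)[OF g that] gV[of I] V[of I] that by (cases "X I = I") (auto simp: F_def)
    then have "g \<in> (\<Pi>\<^sub>E I\<in>intervals. X I)"
      using rollerD(1)[OF g] by (auto simp: PiE_iff)
    then show ?thesis
      using X(4) U'(2) g by blast
  qed
  ultimately show ?thesis
    using that by blast
qed

lemma Hausdorff_space_roller: "Hausdorff_space (roller_topology :: ('a::median_space set \<Rightarrow> 'a) topology)"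
  unfolding roller_topology_def
  by (intro Hausdorff_space_subtopology) (simp add: Hausdorff_space_product_topology Hausdorff_space_subtopology)

lemma topological_median_algebra_roller:
  "topological_median_algebra (roller_topology :: ('a::median_space set \<Rightarrow> 'a) topology) roller_median"
proof -
  let ?T = "roller_topology :: ('a set \<Rightarrow> 'a) topology"
  have "continuous_map (prod_topology ?T (prod_topology ?T ?T)) ?T
    (\<lambda>p. roller_median (fst p) (fst (snd p)) (snd (snd p)))"
  proof (rule continuous_map_into_roller)
    fix I :: "'a set" assume I: "I \<in> intervals"
    let ?T3 = "prod_topology ?T (prod_topology ?T ?T)"
    have comp: "continuous_map ?T3 ?T fst" "continuous_map ?T3 ?T (\<lambda>p. fst (snd p))"
      "continuous_map ?T3 ?T (\<lambda>p. snd (snd p))"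
      using continuous_map_compose[OF continuous_map_snd continuous_map_fst, of ?T ?T ?T]
        continuous_map_compose[OF continuous_map_snd continuous_map_snd, of ?T ?T ?T]
      by (simp_all add: continuous_map_fst comp_def)
    note * = continuous_map_compose[OF _ continuous_map_roller_apply[OF I], unfolded comp_def]
    show "continuous_map (prod_topology ?T (prod_topology ?T ?T)) euclidean
      (\<lambda>p. roller_median (fst p) (fst (snd p)) (snd (snd p)) I)"
      unfolding roller_median_apply[OF I]
      by (intro continuous_map_median *[OF comp(1)] *[OF comp(2)] *[OF comp(3)])
  qed (auto simp: topspace_roller_topology roller_median_in_roller)
  then show ?thesis
    using median_algebra_roller Hausdorff_space_roller
    by (simp add: topological_median_algebra_def topspace_roller_topology case_prod_unfold)
qed

lemma compact_space_roller:
  assumes "compact_median_intervals (euclidean :: 'a::median_space topology) median"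
  shows "compact_space (roller_topology :: ('a set \<Rightarrow> 'a) topology)"
proof -
  let ?P = "product_topology (\<lambda>I::'a set. top_of_set I) intervals"
  have "compact I" if "I \<in> intervals" for I :: "'a set"
    using assms that
    by (auto simp: compact_median_intervals_def median_interval_def median_eq_iff intervals_def)
  then have P: "compact_space ?P"
    by (auto simp: compact_space_product_topology compact_space_subtopology)
  have proj: "continuous_map ?P euclidean (\<lambda>f. f I)" if "I \<in> intervals" for I :: "'a set"
    using continuous_map_product_projection[OF that, of "\<lambda>I. top_of_set I"]
    by (simp add: continuous_map_in_subtopology)
  \<comment> \<open>Each compatibility condition equates two continuous maps into a Hausdorff
    space.\<close>
  have closed: "closedin ?P {f \<in> topspace ?P. gate (I \<inter> J) (f I) = gate (I \<inter> J) (f J)}"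
    if "I \<in> intervals" "J \<in> intervals" "I \<inter> J \<noteq> {}" for I J :: "'a set"
    using that intervals_Int
    by (intro closedin_continuous_maps_eq[where Y = euclidean]
        continuous_map_compose[OF proj continuous_map_gate, unfolded comp_def]) auto
  \<comment> \<open>Inserting the whole space makes the family visibly nonempty and retains
    membership in the product.\<close>
  have "closedin ?P (\<Inter>(insert (topspace ?P)
      {{f \<in> topspace ?P. gate (I \<inter> J) (f I) = gate (I \<inter> J) (f J)} | I J.
        I \<in> intervals \<and> J \<in> intervals \<and> I \<inter> J \<noteq> {}}))"
    by (intro closedin_Inter) (use closed closedin_topspace[of ?P] in blast)+
  also have "\<Inter>(insert (topspace ?P)
      {{f \<in> topspace ?P. gate (I \<inter> J) (f I) = gate (I \<inter> J) (f J)} | I J.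
        I \<in> intervals \<and> J \<in> intervals \<and> I \<inter> J \<noteq> {}}) = roller"
    unfolding roller_def by (simp; blast)
  finally show ?thesis
    unfolding roller_topology_def
    by (intro compact_space_subtopology closedin_compact_space P)
qed

lemma locally_median_convex_roller:
  assumes "locally_median_convex (euclidean :: 'a::median_space topology) median"
  shows "locally_median_convex (roller_topology :: ('a set \<Rightarrow> 'a) topology) roller_median"
  unfolding locally_median_convex_def neighbourhood_base_of topspace_roller_topology
proof (intro allI impI)
  fix W and f :: "'a set \<Rightarrow> 'a"
  assume W: "openin roller_topology W \<and> f \<in> W"
  then have f: "f \<in> roller"
    using openin_subset topspace_roller_topology by blast
  obtain F V where F: "finite F" "F \<subseteq> intervals"
    and V: "\<And>I. I \<in> F \<Longrightarrow> open (V I) \<and> f I \<in> V I"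
    and sub: "\<And>g. g \<in> roller \<Longrightarrow> (\<And>I. I \<in> F \<Longrightarrow> g I \<in> V I) \<Longrightarrow> g \<in> W"
    using openin_roller_basis W by metis
  \<comment> \<open>A convex neighbourhood is chosen in each of the finitely many constrained
    coordinates; the resulting box is convex because betweenness passes to components.\<close>
  have "\<exists>A C. open A \<and> median_convex UNIV median C \<and> f I \<in> A \<and> A \<subseteq> C \<and> C \<subseteq> V I" if "I \<in> F" for I
    using assms V[OF that] by (auto simp: locally_median_convex_def neighbourhood_base_of)
  then obtain A C where AC: "\<And>I. I \<in> F \<Longrightarrow>
      open (A I) \<and> median_convex UNIV median (C I) \<and> f I \<in> A I \<and> A I \<subseteq> C I \<and> C I \<subseteq> V I"
    by metis
  let ?A = "{g \<in> roller. \<forall>I\<in>F. g I \<in> A I}" and ?C = "{g \<in> roller. \<forall>I\<in>F. g I \<in> C I}"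
  have "openin roller_topology ?A"
    using F AC by (intro openin_roller_finite) auto
  moreover have "median_convex roller roller_median ?C"
    unfolding median_convex_def
  proof (intro conjI ballI subsetI)
    fix g h k assume gh: "g \<in> ?C" "h \<in> ?C" and k: "k \<in> median_interval roller roller_median g h"
    have "k I \<in> C I" if "I \<in> F" for I
    proof -
      have "k I \<in> metric_interval (g I) (h I)"
        using median_interval_roller[OF k] that F(2) by blast
      then have "k I \<in> median_interval UNIV median (g I) (h I)"
        by (simp add: median_interval_def median_eq_iff)
      then show ?thesis
        using AC[OF that] gh that unfolding median_convex_def by blast
    qed
    then show "k \<in> ?C"
      using k by (auto simp: median_interval_def)
  qed auto
  moreover have "f \<in> ?A" "?A \<subseteq> ?C" "?C \<subseteq> W"
    using f AC sub by blast+
  ultimately show "\<exists>U V. openin roller_topology U \<and> median_convex roller roller_median V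
      \<and> f \<in> U \<and> U \<subseteq> V \<and> V \<subseteq> W"
    by blast
qed

text \<open>The component at the interval between \<open>x\<close> and \<open>y\<close> separates
  them, since its gate fixes both.\<close>

lemma inj_roller_inclusion: "inj (roller_inclusion :: 'a::median_space \<Rightarrow> 'a set \<Rightarrow> 'a)"
proof (rule injI)
  fix x y :: 'a
  assume eq: "roller_inclusion x = roller_inclusion y"
  have "gate (metric_interval x y) x = gate (metric_interval x y) y"
    using fun_cong[OF eq, of "metric_interval x y"] by (simp del: gate_metric_interval)
  then show "x = y"
    using gate_fixed[OF metric_interval_in_intervals] by (metis metric_interval_ends)
qed

lemma continuous_map_roller_inclusion:
  "continuous_map euclidean roller_topology (roller_inclusion :: 'a::median_space \<Rightarrow> 'a set \<Rightarrow> 'a)"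
  by (rule continuous_map_into_roller)
    (simp_all only: roller_inclusion_in_roller roller_inclusion_apply continuous_map_gate)

lemma median_morphism_roller_inclusion:
  "median_morphism UNIV median roller roller_median (roller_inclusion :: 'a::median_space \<Rightarrow> 'a set \<Rightarrow> 'a)"
  unfolding median_morphism_def
  by (intro conjI ballI roller_eqI roller_median_in_roller)
    (simp_all add: gate_median roller_inclusion_in_roller)

section \<open>The image of the inclusion\<close>

text \<open>A point \<open>f\<close> between the images of \<open>x\<close> and \<open>y\<close> is the image of its component at \<open>I(x, y)\<close>.  For
  an interval \<open>J\<close> disjoint from \<open>I(x, y)\<close> this is seen by passing from \<open>J\<close> to the interval between
  the gates of \<open>x\<close> and \<open>y\<close> in \<open>J\<close>, which is contained in an interval starting at \<open>x\<close>.\<close>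

lemma median_convex_roller_inclusion:
  "median_convex roller roller_median (range (roller_inclusion :: 'a::median_space \<Rightarrow> 'a set \<Rightarrow> 'a))"
  unfolding median_convex_def
proof (intro conjI ballI subsetI)
  fix u v f
  assume "u \<in> range roller_inclusion" "v \<in> range roller_inclusion"
    and f: "f \<in> median_interval roller roller_median u (v :: 'a set \<Rightarrow> 'a)"
  then obtain x y :: 'a where uv: "u = roller_inclusion x" "v = roller_inclusion y"
    by auto
  have fr: "f \<in> roller"
    using f by (simp add: median_interval_def)
  have between: "f J \<in> metric_interval (gate J x) (gate J y)" if "J \<in> intervals" for J
    using median_interval_roller[OF f that] uv that by simp
  define I where "I = metric_interval x y"
  define z where "z = f I"
  have I: "I \<in> intervals" "x \<in> I" "y \<in> I"
    by (auto simp: I_def)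
  have z: "z \<in> I"
    using rollerD(2)[OF fr I(1)] by (simp add: z_def)
  \<comment> \<open>The gates of \<open>x\<close> and \<open>y\<close> in \<open>J\<close> lie in
    \<open>I \<inter> J\<close>, hence so does \<open>f J\<close> between them, and there
    compatibility with \<open>I\<close> determines it.\<close>
  have meet: "f J = gate J z" if J: "J \<in> intervals" "I \<inter> J \<noteq> {}" for J
  proof -
    have "gate J x \<in> I \<inter> J" "gate J y \<in> I \<inter> J"
      using gate_in_Int I J by metis+
    then have "f J \<in> I \<inter> J"
      using between[OF J(1)] metric_interval_subset[OF intervals_Int[OF I(1) J]] by blast
    then have "f J = gate (I \<inter> J) (f J)"
      using gate_fixed[OF intervals_Int[OF I(1) J]] by simp
    also have "\<dots> = gate (I \<inter> J) z"
      using rollerD(3)[OF fr I(1) J] by (simp add: z_def)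
    also have "\<dots> = gate J z"
      by (rule gate_Int[OF I(1) J z])
    finally show ?thesis .
  qed
  have "f J = gate J z" if J: "J \<in> intervals" for J
  proof -
    define x' y' where "x' = gate J x" and "y' = gate J y"
    \<comment> \<open>\<open>K\<close> contains \<open>x\<close>, so it meets \<open>I\<close> and
      \<open>meet\<close> applies to it. It also contains \<open>x'\<close>, because the gate of
      \<open>x\<close> in \<open>J\<close> lies between \<open>x\<close> and
      \<open>y'\<close>.\<close>
    define J' K where "J' = metric_interval x' y'" and "K = metric_interval x y'"
    have [simp]: "J' \<in> intervals" "K \<in> intervals"
      by (auto simp: J'_def K_def)
    have xy': "x' \<in> J" "y' \<in> J"
      using gate_in[OF J] by (auto simp: x'_def y'_def)
    then have "J' \<subseteq> J"
      using metric_interval_subset[OF J] by (simp add: J'_def)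
    have "x' \<in> K" "y' \<in> K"
      using gate_between[OF J xy'(2), of x] by (auto simp: K_def x'_def)
    then have "J' \<subseteq> K"
      using metric_interval_subset[of K] by (simp add: J'_def)
    have "f J \<in> J'"
      using between[OF J] by (simp add: J'_def x'_def y'_def)
    then have "f J = f J'"
      using roller_gate_subset[OF fr _ J \<open>J' \<subseteq> J\<close>] gate_fixed[of J' "f J"] by simp
    also have "\<dots> = gate J' (gate K z)"
      using roller_gate_subset[OF fr _ _ \<open>J' \<subseteq> K\<close>] meet[of K] I(2) K_def by fastforce
    also have "\<dots> = gate J' (gate J z)"
      using gate_gate_subset \<open>J' \<subseteq> J\<close> \<open>J' \<subseteq> K\<close> J by (metis \<open>J' \<in> intervals\<close> \<open>K \<in> intervals\<close>)
    also have "gate J z \<in> J'"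
      using gate_mono_interval[OF J] z by (auto simp: I_def J'_def x'_def y'_def)
    then have "gate J' (gate J z) = gate J z"
      by (simp add: gate_fixed)
    finally show ?thesis .
  qed
  then have "f = roller_inclusion z"
    by (intro roller_eqI fr roller_inclusion_in_roller) simp
  then show "f \<in> range roller_inclusion"
    by blast
qed (auto simp: roller_inclusion_in_roller)

section \<open>Helly property and density\<close>

lemma median_convexD:
  "median_convex UNIV median C \<Longrightarrow> x \<in> C \<Longrightarrow> y \<in> C \<Longrightarrow> z \<in> metric_interval x y \<Longrightarrow> z \<in> C"
  by (auto simp: median_convex_def median_interval_def median_eq_iff)

text \<open>Pick one point from each pairwise intersection. Each set contains two of the three
  points, hence their median.\<close>

lemma median_convex_helly3:
  fixes A B C :: "'a::median_space set"
  assumes "median_convex UNIV median A" "median_convex UNIV median B" "median_convex UNIV median C"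
    and "A \<inter> B \<noteq> {}" "B \<inter> C \<noteq> {}" "C \<inter> A \<noteq> {}"
  shows "A \<inter> B \<inter> C \<noteq> {}"
proof -
  obtain a b c where abc: "a \<in> A \<inter> B" "b \<in> B \<inter> C" "c \<in> C \<inter> A"
    using assms by blast
  then have "median a b c \<in> B" "median a b c \<in> C" "median a b c \<in> A"
    using assms(1-3) median_in[of a b c] median_convexD by blast+
  then show ?thesis
    by blast
qed

lemma median_convex_Int:
  "median_convex M m A \<Longrightarrow> median_convex M m B \<Longrightarrow> median_convex M m (A \<inter> B)"
  unfolding median_convex_def by blast

lemma median_convex_helly:
  fixes A :: "'i \<Rightarrow> 'a::median_space set"
  assumes "finite S"
    and "\<And>i. i \<in> S \<Longrightarrow> median_convex UNIV median (A i)"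
    and "\<And>i j. i \<in> S \<Longrightarrow> j \<in> S \<Longrightarrow> A i \<inter> A j \<noteq> {}"
  shows "(\<Inter>i\<in>S. A i) \<noteq> {}"
  using assms
proof (induction S arbitrary: A rule: finite_induct)
  case (insert i S)
  \<comment> \<open>Cutting every set down to \<open>A i\<close> keeps the family convex and, by the
    case of three sets, pairwise intersecting.\<close>
  have "(\<Inter>j\<in>S. A i \<inter> A j) \<noteq> {}"
  proof (rule insert.IH)
    fix j k assume "j \<in> S" "k \<in> S"
    then have "A i \<inter> A j \<inter> A k \<noteq> {}"
      using insert.prems by (intro median_convex_helly3) auto
    then show "A i \<inter> A j \<inter> (A i \<inter> A k) \<noteq> {}"
      by blast
  qed (use insert.prems median_convex_Int in blast)
  \<comment> \<open>For empty \<open>S\<close> the intersection just treated is the whole space and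
    says nothing about \<open>A i\<close>; the pairwise hypothesis with both indices equal to
    \<open>i\<close> makes \<open>A i\<close> nonempty.\<close>
  then show ?case
    using insert.prems(2)[of i i] by (cases "S = {}") auto
qed simp

text \<open>The gate sends a point between two points of the fibre into the interval from
  \<open>p\<close> to \<open>p\<close>, which is a singleton.\<close>

lemma median_convex_gate_fibre:
  fixes I :: "'a::median_space set"
  assumes "I \<in> intervals"
  shows "median_convex UNIV median {x. gate I x = p}"
  unfolding median_convex_def
proof (intro conjI ballI subsetI)
  fix x y z
  assume "x \<in> {x. gate I x = p}" "y \<in> {x. gate I x = p}" "z \<in> median_interval UNIV median x y"
  then show "z \<in> {x. gate I x = p}"
    using gate_mono_interval[OF assms, of z x y]
    by (simp add: median_interval_def median_eq_iff)
qed simp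

text \<open>The fibres over two components \<open>f I\<close> and \<open>f J\<close> meet in the component of \<open>f\<close> at the interval
  between \<open>f I\<close> and \<open>f J\<close>.\<close>

lemma roller_gate_connecting:
  fixes f :: "'a::median_space set \<Rightarrow> 'a"
  assumes f: "f \<in> roller" and I: "I \<in> intervals" and K: "K \<in> intervals" and p: "f I \<in> K"
  shows "gate I (f K) = f I"
proof -
  have fI: "f I \<in> I \<inter> K"
    using rollerD(2)[OF f I] p by blast
  then have ne: "K \<inter> I \<noteq> {}" "I \<inter> K \<noteq> {}"
    by auto
  have "gate I (f K) = gate (I \<inter> K) (f K)"
    using gate_Int[OF K I ne(1) rollerD(2)[OF f K]] by (simp add: Int_commute)
  also have "\<dots> = gate (I \<inter> K) (f I)"
    using rollerD(3)[OF f I K ne(2)] by simp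
  also have "\<dots> = f I"
    using gate_fixed[OF intervals_Int[OF I K ne(2)] fI] .
  finally show ?thesis .
qed

text \<open>This is density in its combinatorial form: a basic open set constrains finitely many
  components, and on these \<open>f\<close> is matched exactly.\<close>

lemma roller_finite_interpolation:
  fixes f :: "'a::median_space set \<Rightarrow> 'a"
  assumes f: "f \<in> roller" and F: "finite F" "F \<subseteq> intervals"
  obtains x where "\<forall>I\<in>F. gate I x = f I"
proof -
  have "(\<Inter>I\<in>F. {x. gate I x = f I}) \<noteq> {}"
  proof (rule median_convex_helly[OF F(1)])
    fix I J assume "I \<in> F" "J \<in> F"
    then have "f (metric_interval (f I) (f J)) \<in> {x. gate I x = f I} \<inter> {x. gate J x = f J}"
      using F(2) roller_gate_connecting[OF f] by auto
    then show "{x. gate I x = f I} \<inter> {x. gate J x = f J} \<noteq> {}"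
      by blast
  qed (use F(2) median_convex_gate_fibre in auto)
  then show ?thesis
    using that by auto
qed

lemma closure_of_roller_inclusion:
  "roller_topology closure_of range (roller_inclusion :: 'a::median_space \<Rightarrow> 'a set \<Rightarrow> 'a) = roller"
proof (rule subset_antisym)
  show "roller_topology closure_of range (roller_inclusion :: 'a \<Rightarrow> 'a set \<Rightarrow> 'a) \<subseteq> roller"
    using closure_of_subset_topspace[of roller_topology] by (simp add: topspace_roller_topology)
  show "roller \<subseteq> roller_topology closure_of range (roller_inclusion :: 'a \<Rightarrow> 'a set \<Rightarrow> 'a)"
  proof
    fix f :: "'a set \<Rightarrow> 'a"
    assume f: "f \<in> roller"
    have "\<exists>g. g \<in> range roller_inclusion \<and> g \<in> U" if U: "f \<in> U" "openin roller_topology U" for U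
    proof -
      obtain F V where FV: "finite F" "F \<subseteq> intervals" "\<And>I. I \<in> F \<Longrightarrow> open (V I) \<and> f I \<in> V I"
        "\<And>g. g \<in> roller \<Longrightarrow> (\<And>I. I \<in> F \<Longrightarrow> g I \<in> V I) \<Longrightarrow> g \<in> U"
        using openin_roller_basis[OF U(2,1)] by metis
      obtain x where "\<forall>I\<in>F. gate I x = f I"
        using roller_finite_interpolation[OF f FV(1,2)] .
      then have "roller_inclusion x \<in> U"
        using FV(2,3) by (intro FV(4) roller_inclusion_in_roller) auto
      then show ?thesis
        by blast
    qed
    then show "f \<in> roller_topology closure_of range roller_inclusion"
      using f by (auto simp: in_closure_of topspace_roller_topology)
  qed
qed

section \<open>Embedding of connected, locally compact spaces\<close>

lemma connected_interval:
  assumes "connected (UNIV::'a::median_space set)"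
  shows "connected (metric_interval x (y::'a))"
proof -
  \<comment> \<open>The gate is a continuous retraction of the whole space onto the
    interval.\<close>
  have "gate (metric_interval x y) ` UNIV = metric_interval x y"
    using gate_in[OF metric_interval_in_intervals] gate_fixed[OF metric_interval_in_intervals]
    by (metis UNIV_I image_eqI image_subsetI subsetI subset_antisym)
  moreover have "continuous_on UNIV (gate (metric_interval x y))"
    using continuous_map_gate[of "metric_interval x y"] by simp
  ultimately show ?thesis
    using connected_continuous_image assms by metis
qed

text \<open>The distances from \<open>x\<close> to the points of the interval form a connected set
  of reals containing 0 and d(x,y).\<close>

lemma interval_intermediate:
  fixes x y :: "'a::median_space"
  assumes "connected (UNIV::'a set)" "0 \<le> r" "r \<le> dist x y"
  obtains s where "s \<in> metric_interval x y" "dist x s = r"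
proof -
  have "connected (dist x ` metric_interval x y)"
    by (intro connected_continuous_image connected_interval assms continuous_intros)
  moreover have "0 \<in> dist x ` metric_interval x y" "dist x y \<in> dist x ` metric_interval x y"
    by (auto intro: rev_image_eqI[of x])
  ultimately have "r \<in> dist x ` metric_interval x y"
    using assms connected_contains_Icc[of _ 0 "dist x y"] by fastforce
  then show ?thesis
    using that by auto
qed

text \<open>By connectedness the interval from \<open>x\<close> to a point \<open>y\<close> far away crosses the compact sphere of
  radius \<open>r\<close> about \<open>x\<close> in a point \<open>s\<close>, and \<open>s\<close> is the gate of \<open>y\<close> in \<open>I(x, s)\<close>.  A finite net on the
  sphere therefore yields finitely many intervals whose gates detect all such \<open>y\<close>.\<close>

lemma roller_inclusion_nbhd:
  fixes x :: "'a::median_space"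
  assumes conn: "connected (UNIV::'a set)" and r: "r > 0" and S: "compact (sphere x r)"
  obtains W where "openin roller_topology W" "roller_inclusion x \<in> W"
    "\<And>y. roller_inclusion y \<in> W \<Longrightarrow> dist x y < r"
proof -
  obtain N where N: "finite N" "N \<subseteq> sphere x r" "sphere x r \<subseteq> (\<Union>s\<in>N. ball s (r/2))"
    using compactE_image[OF S, of "sphere x r" "\<lambda>s. ball s (r/2)"] r by force
  define W where "W = {f \<in> roller. \<forall>I\<in>metric_interval x ` N. f I \<in> ball x (r/2)}"
  have "openin roller_topology W"
    unfolding W_def using N(1) by (intro openin_roller_finite) auto
  moreover have "roller_inclusion x \<in> W"
    using r roller_inclusion_in_roller median_eqI[of x x _ x]
    by (auto simp: W_def)
  moreover have "dist x y < r" if W: "roller_inclusion y \<in> W" for y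
  proof (rule ccontr)
    assume "\<not> dist x y < r"
    then obtain s where s: "s \<in> metric_interval x y" "dist x s = r"
      using interval_intermediate[OF conn, of r x y] r by auto
    then obtain t where t: "t \<in> N" "dist t s < r/2"
      using N(3) by fastforce
    \<comment> \<open>Moving the endpoint \<open>s\<close> to \<open>t\<close> moves the gate of
      \<open>y\<close> by less than r/2. The moved gate is within r/2 of \<open>x\<close> by the
      choice of \<open>W\<close>, while \<open>s\<close> is at distance r from
      \<open>x\<close>.\<close>
    have "median x s y = s"
      using s(1) median_eq_iff median_commute(2) by metis
    then have "dist (median x t y) s < r/2"
      using dist_median_le[of x y t s] t(2) median_commute(2) by (metis order_le_less_trans)
    moreover have "dist x (median x t y) < r/2"
      using W t(1) by (auto simp: W_def)
    ultimately show False
      using s(2) dist_triangle[of x s "median x t y"] by linarith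
  qed
  ultimately show ?thesis
    using that by blast
qed

text \<open>A continuous injection is an embedding once it is open onto its image, so each
  neighbourhood of a point must contain the preimage of an open set around the image point. Local
  compactness supplies the compact sphere that produces this open set.\<close>

lemma embedding_map_roller_inclusion:
  assumes conn: "connected (UNIV :: 'a::median_space set)"
    and lc: "locally_compact_space (euclidean :: 'a topology)"
  shows "embedding_map euclidean roller_topology (roller_inclusion :: 'a \<Rightarrow> 'a set \<Rightarrow> 'a)"
proof -
  let ?\<iota> = "roller_inclusion :: 'a \<Rightarrow> 'a set \<Rightarrow> 'a"
  have nbhd: "\<exists>W. openin roller_topology W \<and> ?\<iota> x \<in> W \<and> (\<forall>y. ?\<iota> y \<in> W \<longrightarrow> y \<in> U)"
    if U: "open U" "x \<in> U" for U :: "'a set" and x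
  proof -
    have "\<exists>V K. open V \<and> compact K \<and> x \<in> V \<and> V \<subseteq> K"
      using lc by (simp add: locally_compact_space_def)
    then obtain V K where VK: "open V" "compact K" "x \<in> V" "V \<subseteq> K"
      by blast
    obtain e where e: "e > 0" "ball x e \<subseteq> U \<inter> V"
      using U VK by (metis IntI open_Int open_contains_ball)
    \<comment> \<open>Halving puts the closed ball, and with it the sphere, inside the compact
      \<open>K\<close>.\<close>
    define r where "r = e/2"
    have r: "r > 0" "cball x r \<subseteq> ball x e"
      using e(1) by (auto simp: r_def)
    have "sphere x r \<subseteq> K"
      using r(2) e(2) VK(4) sphere_cball[of x r] by blast
    moreover have closed: "closed (sphere x r)"
      unfolding sphere_def by (intro closed_Collect_eq continuous_intros)
    ultimately have "compact (sphere x r)"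
      using compact_Int_closed[OF VK(2), of "sphere x r"] closed by (simp add: Int_absorb1)
    then obtain W where "openin roller_topology W" "?\<iota> x \<in> W" "\<And>y. ?\<iota> y \<in> W \<Longrightarrow> dist x y < r"
      using roller_inclusion_nbhd[OF conn r(1)] by metis
    moreover have "y \<in> U" if "dist x y < r" for y
      using that r(2) e(2) by (force simp: less_imp_le)
    ultimately show ?thesis
      by blast
  qed
  have "open_map euclidean (subtopology roller_topology (range ?\<iota>)) ?\<iota>"
    unfolding open_map_def
  proof (intro allI impI)
    fix U :: "'a set" assume U: "openin euclidean U"
    \<comment> \<open>The union of all open sets whose preimage lies in \<open>U\<close> avoids
      choosing one for each point.\<close>
    define W where "W = \<Union>{W. openin roller_topology W \<and> (\<forall>y. ?\<iota> y \<in> W \<longrightarrow> y \<in> U)}"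
    have "openin roller_topology W"
      unfolding W_def by (rule openin_Union) simp
    moreover have "?\<iota> ` U = W \<inter> range ?\<iota>"
      using nbhd U unfolding W_def by fastforce
    ultimately show "openin (subtopology roller_topology (range ?\<iota>)) (?\<iota> ` U)"
      unfolding openin_subtopology by blast
  qed
  then have "homeomorphic_map euclidean (subtopology roller_topology (range ?\<iota>)) ?\<iota>"
    using continuous_map_roller_inclusion inj_roller_inclusion roller_inclusion_in_roller
    by (intro bijective_open_imp_homeomorphic_map)
      (auto simp: continuous_map_in_subtopology topspace_roller_topology)
  then show ?thesis
    by (simp add: embedding_map_def)
qed

theorem theorem3:
  assumes "complete (UNIV :: 'a::median_space set)"
    and "locally_median_convex (euclidean :: 'a topology) median"
    and "compact_median_intervals (euclidean :: 'a topology) median"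
  shows "topological_median_algebra (roller_topology :: ('a set \<Rightarrow> 'a) topology) roller_median
    \<and> compact_space (roller_topology :: ('a set \<Rightarrow> 'a) topology)
    \<and> locally_median_convex (roller_topology :: ('a set \<Rightarrow> 'a) topology) roller_median
    \<and> inj (roller_inclusion :: 'a \<Rightarrow> 'a set \<Rightarrow> 'a)
    \<and> continuous_map euclidean roller_topology (roller_inclusion :: 'a \<Rightarrow> 'a set \<Rightarrow> 'a)
    \<and> median_morphism UNIV median roller roller_median (roller_inclusion :: 'a \<Rightarrow> 'a set \<Rightarrow> 'a)
    \<and> median_convex roller roller_median (range (roller_inclusion :: 'a \<Rightarrow> 'a set \<Rightarrow> 'a))
    \<and> roller_topology closure_of range (roller_inclusion :: 'a \<Rightarrow> 'a set \<Rightarrow> 'a) = roller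
    \<and> (connected (UNIV :: 'a set) \<and> locally_compact_space (euclidean :: 'a topology) \<longrightarrow>
        embedding_map euclidean roller_topology (roller_inclusion :: 'a \<Rightarrow> 'a set \<Rightarrow> 'a))"
  using topological_median_algebra_roller compact_space_roller[OF assms(3)]
    locally_median_convex_roller[OF assms(2)] inj_roller_inclusion continuous_map_roller_inclusion
    median_morphism_roller_inclusion median_convex_roller_inclusion closure_of_roller_inclusion
    embedding_map_roller_inclusion
  by blast

end
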